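(* The idempotents of $M_2(\bar{\mathbb{R}})$ (matrices $E$ with $E^2=E$) are exactly the matrices of the form $$\begin{pmatrix} 0 & x \\ y & x+y \end{pmatrix},\quad \begin{pmatrix} 0 & x \\ y & 0 \end{pmatrix},\quad \begin{pmatrix} x+y & x \\ y & 0 \end{pmatrix}\quad\text{and}\quad \begin{pmatrix} -\infty & -\infty \\ -\infty & -\infty \end{pmatrix},$$ where $x,y \in \bar{\mathbb{R}}$ with $x+y \leq 0$.
   Context: $\bar{\mathbb{R}} = \mathbb{R} \cup \{-\infty\}$ is the tropical semiring with $a \otimes b = a+b$ (with $-\infty$ absorbing) and $a \oplus b = \max\{a,b\}$. $M_2(\bar{\mathbb{R}})$ is the monoid of $2 \times 2$ matrices over $\bar{\mathbb{R}}$ under tropical matrix multiplication $(AB)_{ij} = \max_{k} (A_{ik} + B_{kj})$. In the displayed matrices $+$ and $0$ are the usual addition (extended to $-\infty$) and the real number zero. *)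

theory Defs
  imports "HOL-Analysis.Analysis"
begin

text \<open>
  The tropical semiring lives inside \<^typ>\<open>ereal\<close>: leaving out \<open>\<infinity>\<close>, the library's addition has \<open>-\<infinity>\<close>
  as absorbing element, so tropical multiplication is \<open>+\<close> and tropical addition is \<open>max\<close>.
\<close>

definition Rbar :: "ereal set" where
  "Rbar = range ereal \<union> {-\<infinity>}"

definition trop_matrices :: "(ereal^'n^'n) set" where
  "trop_matrices = {A. \<forall>i j. A $ i $ j \<in> Rbar}"

definition trop_mult :: "ereal^'n^'n \<Rightarrow> ereal^'n^'n \<Rightarrow> ereal^'n^'n"  (infixl "\<odot>" 70) where
  "A \<odot> B = (\<chi> i j. MAX k. A $ i $ k + B $ k $ j)"

definition mat2 :: "'a::zero \<Rightarrow> 'a \<Rightarrow> 'a \<Rightarrow> 'a \<Rightarrow> 'a^2^2" where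
  "mat2 a b c d = vector [vector [a, b], vector [c, d]]"

lemma Rbar_add: "x \<in> Rbar \<Longrightarrow> y \<in> Rbar \<Longrightarrow> x + y \<in> Rbar"
  unfolding Rbar_def by (cases x; cases y) auto

lemma trop_mult_closed:
  assumes "A \<in> trop_matrices" and "B \<in> trop_matrices"
  shows "A \<odot> B \<in> trop_matrices"
proof -
  have "(MAX k. A $ i $ k + B $ k $ j) \<in> Rbar" for i j
  proof -
    have "(MAX k. A $ i $ k + B $ k $ j) \<in> range (\<lambda>k. A $ i $ k + B $ k $ j)"
      by (rule Max_in) auto
    moreover have "range (\<lambda>k. A $ i $ k + B $ k $ j) \<subseteq> Rbar"
      using assms by (auto simp: trop_matrices_def intro!: Rbar_add)
    ultimately show ?thesis by blast
  qed
  then show ?thesis by (simp add: trop_matrices_def trop_mult_def)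
qed

end

theory Submission
  imports Defs
begin

text \<open>
  For \<open>E = mat2 a b c d\<close> the matrix equation \<open>E \<odot> E = E\<close> is four scalar equations. The off-diagonal
  entries enter the two diagonal ones only through \<open>s = b + c\<close>, the weight of the cycle through both
  indices; the diagonal entries enter the two off-diagonal ones only through \<open>max a d\<close>.
  The diagonal equation \<open>max (a + a) s = a\<close> says that \<open>s \<le> 0\<close> and \<open>a \<in> {0, s}\<close>
  (\<open>max_double_eq_iff\<close>), and likewise for \<open>d\<close>. The off-diagonal equations say that \<open>b\<close> and \<open>c\<close> are
  fixed under adding \<open>max a d\<close>, so either \<open>max a d = 0\<close> or \<open>b\<close> and \<open>c\<close> are both \<open>-\<infinity>\<close>
  (\<open>max_add_eq_iff\<close>). If one of \<open>a\<close>, \<open>d\<close> is \<open>0\<close>, the other one is \<open>0\<close> or \<open>s\<close>: these are the three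
  families of the theorem. If neither is \<open>0\<close>, then both equal \<open>s\<close> and are negative, which forces
  \<open>b = c = -\<infinity>\<close> and hence \<open>s = -\<infinity>\<close>: this is the zero matrix.
\<close>

lemma Rbar_iff: "x \<in> Rbar \<longleftrightarrow> x \<noteq> \<infinity>"
  by (cases x) (auto simp: Rbar_def)

lemma mat2_nth [simp]:
  "mat2 a b c d $ 1 $ 1 = a" "mat2 a b c d $ 1 $ 2 = b"
  "mat2 a b c d $ 2 $ 1 = c" "mat2 a b c d $ 2 $ 2 = d"
  by (simp_all add: mat2_def)

lemma mat2_eta: "mat2 (A $ 1 $ 1) (A $ 1 $ 2) (A $ 2 $ 1) (A $ 2 $ 2) = A"
  by (simp add: vec_eq_iff forall_2)

lemma mat2_eq_iff: "mat2 a b c d = mat2 a' b' c' d' \<longleftrightarrow> a = a' \<and> b = b' \<and> c = c' \<and> d = d'"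
  by (auto simp: vec_eq_iff forall_2)

lemma mat2_in_trop_matrices_iff:
  "mat2 a b c d \<in> trop_matrices \<longleftrightarrow> a \<in> Rbar \<and> b \<in> Rbar \<and> c \<in> Rbar \<and> d \<in> Rbar"
  by (auto simp: trop_matrices_def forall_2)

lemma trop_mult_mat2:
  "mat2 a b c d \<odot> mat2 a' b' c' d' =
     mat2 (max (a + a') (b + c')) (max (a + b') (b + d'))
          (max (c + a') (d + c')) (max (c + b') (d + d'))"
  by (simp add: vec_eq_iff forall_2 trop_mult_def UNIV_2)

text \<open>
  From \<open>a + a \<le> a\<close> follows \<open>a \<le> 0\<close>, whence \<open>s \<le> a \<le> 0\<close>. The maximum is attained either by \<open>s\<close>, so
  \<open>a = s\<close>, or by \<open>a + a\<close>, so \<open>a + a = a\<close>; the latter means \<open>a = 0\<close>, or \<open>a = -\<infinity>\<close> and then \<open>s = -\<infinity> = a\<close>.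
  Conversely \<open>s \<le> 0\<close> gives both \<open>max 0 s = 0\<close> and \<open>max (s + s) s = s\<close>.
\<close>

lemma max_double_eq_iff:
  fixes a s :: ereal
  assumes "a \<in> Rbar" "s \<in> Rbar"
  shows "max (a + a) s = a \<longleftrightarrow> s \<le> 0 \<and> (a = 0 \<or> a = s)"
  using assms by (cases a; cases s) (auto simp: Rbar_iff max_def)

lemma max_add_eq_iff:
  fixes a b d :: ereal
  assumes "a \<in> Rbar" "b \<in> Rbar" "d \<in> Rbar"
  shows "max (a + b) (d + b) = b \<longleftrightarrow> b = -\<infinity> \<or> max a d = 0"
  using assms by (cases a; cases b; cases d) (auto simp: Rbar_iff max_def)

lemma mat2_idempotent_iff:
  assumes Rbar: "a \<in> Rbar" "b \<in> Rbar" "c \<in> Rbar" "d \<in> Rbar"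
  shows "mat2 a b c d \<odot> mat2 a b c d = mat2 a b c d \<longleftrightarrow>
    b + c \<le> 0 \<and> (a = 0 \<and> d = b + c \<or> a = 0 \<and> d = 0 \<or> a = b + c \<and> d = 0) \<or>
    a = -\<infinity> \<and> b = -\<infinity> \<and> c = -\<infinity> \<and> d = -\<infinity>"
    (is "?idem \<longleftrightarrow> ?families")
proof -
  define s where "s = b + c"
  have s: "s \<in> Rbar"
    using Rbar by (simp add: s_def Rbar_add)
  have "?idem \<longleftrightarrow> max (a + a) s = a \<and> max (d + d) s = d \<and>
      max (a + b) (d + b) = b \<and> max (a + c) (d + c) = c"
    by (auto simp: trop_mult_mat2 mat2_eq_iff s_def add.commute max.commute)
  also have "\<dots> \<longleftrightarrow> s \<le> 0 \<and> (a = 0 \<or> a = s) \<and> (d = 0 \<or> d = s) \<and>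
      (b = -\<infinity> \<and> c = -\<infinity> \<or> max a d = 0)"
    using Rbar s by (auto simp: max_double_eq_iff max_add_eq_iff)
  also have "\<dots> \<longleftrightarrow> ?families"
    \<comment> \<open>Without a zero on the diagonal, \<open>max a d = s \<noteq> 0\<close>, so \<open>b\<close> and \<open>c\<close> vanish tropically.\<close>
    by (cases "a = 0"; cases "d = 0") (auto simp: s_def max_def)
  finally show ?thesis .
qed

theorem proposition4p1:
  "{E :: ereal^2^2. E \<in> trop_matrices \<and> E \<odot> E = E} =
     {mat2 0 x
           y (x + y) | x y. x \<in> Rbar \<and> y \<in> Rbar \<and> x + y \<le> 0}
   \<union> {mat2 0 x
           y 0 | x y. x \<in> Rbar \<and> y \<in> Rbar \<and> x + y \<le> 0}
   \<union> {mat2 (x + y) x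
           y 0 | x y. x \<in> Rbar \<and> y \<in> Rbar \<and> x + y \<le> 0}
   \<union> {mat2 (-\<infinity>) (-\<infinity>)
           (-\<infinity>) (-\<infinity>)}"
  (is "?idempotents = ?families")
proof (rule set_eqI)
  fix E :: "ereal^2^2"
  define a b c d where entries: "a = E $ 1 $ 1" "b = E $ 1 $ 2" "c = E $ 2 $ 1" "d = E $ 2 $ 2"
  have E: "E = mat2 a b c d"
    by (simp add: entries mat2_eta)
  have "E \<in> ?idempotents \<longleftrightarrow> a \<in> Rbar \<and> b \<in> Rbar \<and> c \<in> Rbar \<and> d \<in> Rbar \<and>
      (b + c \<le> 0 \<and> (a = 0 \<and> d = b + c \<or> a = 0 \<and> d = 0 \<or> a = b + c \<and> d = 0) \<or>
       a = -\<infinity> \<and> b = -\<infinity> \<and> c = -\<infinity> \<and> d = -\<infinity>)"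
    by (auto simp: E mat2_in_trop_matrices_iff mat2_idempotent_iff)
  also have "\<dots> \<longleftrightarrow> E \<in> ?families"
    by (auto simp: E mat2_eq_iff Rbar_iff)
  finally show "E \<in> ?idempotents \<longleftrightarrow> E \<in> ?families" .
qed

end
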